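(* Let $K$ be a convex body in $\mathbb{R}^n$. For every $\varepsilon>0$ there exist an $m\in\mathbb{N}$ and a convex body $K_m\subset\mathbb{R}^n$ such that $K_m$ is uniquely determined by its geometric moments up to order $m$ among all convex bodies in $\mathbb{R}^n$ (that is, every convex body $L\subset\mathbb{R}^n$ with $\mu_\alpha(L)=\mu_\alpha(K_m)$ for all $\alpha\in\mathbb{N}_0^n$ with $|\alpha|\le m$ satisfies $L=K_m$), and \[\delta_H(K,K_m)\le\varepsilon.\]
   Context: A convex body is a compact, convex subset of $\mathbb{R}^n$ with nonempty interior; $\delta_H$ is the Hausdorff metric. For a compact set $K\subset\mathbb{R}^n$ and $\alpha\in\mathbb{N}_0^n$, the geometric moment of order $|\alpha|=\alpha_1+\dots+\alpha_n$ is $\mu_\alpha(K)=\int_K x_1^{\alpha_1}\cdots x_n^{\alpha_n}\,dx$. *)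

theory Defs
  imports "HOL-Analysis.Analysis"
begin

definition convex_body :: "(real ^ 'n) set \<Rightarrow> bool" where
  "convex_body K \<longleftrightarrow> compact K \<and> convex K \<and> interior K \<noteq> {}"

text \<open>
  The index type \<open>'n\<close> plays the role of the coordinate set of n-space, so that a multi-index is
  a function from \<open>'n\<close> to the naturals.
\<close>

definition mi_order :: "('n::finite \<Rightarrow> nat) \<Rightarrow> nat" where
  "mi_order \<alpha> = (\<Sum>i\<in>UNIV. \<alpha> i)"

definition geom_moment :: "('n::finite \<Rightarrow> nat) \<Rightarrow> (real ^ 'n) set \<Rightarrow> real" where
  "geom_moment \<alpha> K = (LINT x:K|lborel. (\<Prod>i\<in>UNIV. (x $ i) ^ \<alpha> i))"

text \<open>
  The suprema are suprema of reals, so this is the Hausdorff distance only for nonempty bounded sets;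
  it is applied only to convex bodies.
\<close>

definition hausdorff_dist :: "'a::metric_space set \<Rightarrow> 'a set \<Rightarrow> real" where
  "hausdorff_dist K L = max (SUP x\<in>K. infdist x L) (SUP y\<in>L. infdist y K)"

definition determined_by_moments :: "nat \<Rightarrow> (real ^ 'n) set \<Rightarrow> bool" where
  "determined_by_moments m K \<longleftrightarrow>
     (\<forall>L. convex_body L \<longrightarrow>
        (\<forall>\<alpha>. mi_order \<alpha> \<le> m \<longrightarrow> geom_moment \<alpha> L = geom_moment \<alpha> K) \<longrightarrow> L = K)"

end

theory Submission
  imports Defs
begin

text \<open>
  A convex body that is a sublevel set \<open>{p \<le> c}\<close> of a polynomial of degree at most \<open>m\<close> is determined
  by its moments up to order \<open>m\<close>: for a competitor \<open>L\<close> with the same moments, the nonnegative function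
  \<open>(p - c) (1\<^sub>L - 1\<^sub>K)\<close> has integral zero, so \<open>L \<subseteq> K\<close>, and equality of the volumes gives \<open>L = K\<close>.
  To approximate \<open>K\<close> by such bodies, separate every point at distance \<open>\<epsilon>\<close> from \<open>K\<close> by a slab
  \<open>{\<bar>l\<bar> \<le> 1}\<close> with \<open>l\<close> affine and \<open>\<bar>l\<bar> < 1\<close> on \<open>K\<close>. By compactness finitely many slabs suffice, and for
  large \<open>k\<close> the set \<open>{(\<Sum>l. l ^ (2 * k)) \<le> 1}\<close> is convex, contains \<open>K\<close> and avoids all points at distance
  \<open>\<epsilon>\<close> from \<open>K\<close>; being connected, it stays within distance \<open>\<epsilon>\<close> of \<open>K\<close>.
\<close>

section \<open>Polynomials of bounded degree\<close>

text \<open>This is the real linear span of the monomial functions of order at most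
  \<open>m\<close>. Generating it inductively lets facts about moments extend to all polynomials by
  rule induction.\<close>

inductive poly_deg_le :: "nat \<Rightarrow> (real ^ 'n \<Rightarrow> real) \<Rightarrow> bool" for m where
  monomial: "mi_order \<alpha> \<le> m \<Longrightarrow> poly_deg_le m (\<lambda>x. \<Prod>i\<in>UNIV. (x $ i) ^ \<alpha> i)"
| add: "poly_deg_le m f \<Longrightarrow> poly_deg_le m g \<Longrightarrow> poly_deg_le m (\<lambda>x. f x + g x)"
| scale: "poly_deg_le m f \<Longrightarrow> poly_deg_le m (\<lambda>x. c * f x)"

lemma poly_deg_le_const: "poly_deg_le m (\<lambda>x. c)"
  using poly_deg_le.scale[OF poly_deg_le.monomial[of "\<lambda>_. 0" m], of c]
  by (simp add: mi_order_def)

lemma poly_deg_le_sum: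
  "(\<And>a. a \<in> A \<Longrightarrow> poly_deg_le m (f a)) \<Longrightarrow> poly_deg_le m (\<lambda>x. \<Sum>a\<in>A. f a x)"
  by (induction A rule: infinite_finite_induct) (auto intro: poly_deg_le_const poly_deg_le.add)

lemma poly_deg_le_mono: "poly_deg_le m f \<Longrightarrow> m \<le> m' \<Longrightarrow> poly_deg_le m' f"
  by (induction rule: poly_deg_le.induct) (auto intro: poly_deg_le.intros)

lemma poly_deg_le_mult_coord:
  assumes "poly_deg_le m f"
  shows "poly_deg_le (Suc m) (\<lambda>x. x $ j * f x)"
  using assms
proof (induction rule: poly_deg_le.induct)
  case (monomial \<alpha>)
  let ?\<beta> = "\<alpha>(j := Suc (\<alpha> j))"
  have "mi_order ?\<beta> = Suc (mi_order \<alpha>)"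
    unfolding mi_order_def by (simp add: sum.remove[of UNIV j])
  moreover have "(\<Prod>i\<in>UNIV. (x $ i) ^ ?\<beta> i) = x $ j * (\<Prod>i\<in>UNIV. (x $ i) ^ \<alpha> i)" for x :: "real ^ 'a"
    by (simp add: prod.remove[of UNIV j])
  ultimately show ?case
    using poly_deg_le.monomial[of ?\<beta> "Suc m"] monomial by simp
next
  case (add f g)
  then show ?case
    using poly_deg_le.add[of "Suc m"] by (simp add: distrib_left)
next
  case (scale f c)
  then show ?case
    using poly_deg_le.scale[of "Suc m" _ c] by (simp add: mult.left_commute)
qed

text \<open>Expanding the inner product in coordinates reduces this to multiplication by single
  coordinates, each raising the degree by one.\<close>

lemma poly_deg_le_mult_affine:
  assumes "poly_deg_le m f"
  shows "poly_deg_le (Suc m) (\<lambda>x. (inner a x + b) * f x)"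
proof -
  have "poly_deg_le (Suc m) (\<lambda>x. (\<Sum>i\<in>UNIV. a $ i * (x $ i * f x)) + b * f x)"
    using assms
    by (intro poly_deg_le.add poly_deg_le.scale poly_deg_le_sum poly_deg_le_mult_coord)
       (auto intro: poly_deg_le_mono)
  then show ?thesis
    by (simp add: inner_vec_def distrib_right sum_distrib_right mult.assoc)
qed

lemma poly_deg_le_affine_power: "poly_deg_le k (\<lambda>x. (inner a x + b) ^ k)"
  by (induction k) (auto intro: poly_deg_le_const poly_deg_le_mult_affine)

lemma continuous_on_poly_deg_le: "poly_deg_le m f \<Longrightarrow> continuous_on S f"
  by (induction rule: poly_deg_le.induct) (auto intro!: continuous_intros)

lemma set_integrable_poly_deg_le:
  "poly_deg_le m f \<Longrightarrow> compact K \<Longrightarrow> set_integrable lborel K f"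
  using borel_integrable_compact[of K f] continuous_on_poly_deg_le[of m f K]
  by (simp add: set_integrable_def indicator_def if_distrib cong: if_cong)

text \<open>Moments are integrals of monomials, so linearity carries the equality to their span;
  compactness supplies the integrability that additivity requires.\<close>

lemma set_integral_poly_deg_le_eq:
  assumes "poly_deg_le m f" and "compact K" "compact L"
    and "\<And>\<alpha>. mi_order \<alpha> \<le> m \<Longrightarrow> geom_moment \<alpha> L = geom_moment \<alpha> K"
  shows "(LINT x:L|lborel. f x) = (LINT x:K|lborel. f x)"
  using assms(1)
proof (induction rule: poly_deg_le.induct)
  case (monomial \<alpha>)
  then show ?case
    using assms(4) by (simp add: geom_moment_def)
next
  case (add f g)
  then show ?case
    using assms(2,3) by (simp add: set_integral_add(2) set_integrable_poly_deg_le)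
qed simp

section \<open>Sublevel sets of polynomials are determined by moments\<close>

text \<open>The set \<open>interior L - K\<close> is open and null, hence empty. A convex body is
  the closure of its interior, so the inclusion passes to all of \<open>L\<close>.\<close>

lemma convex_body_subset_if_AE:
  fixes K L :: "(real ^ 'n) set"
  assumes "convex_body L" "closed K" and AE: "AE x in lborel. x \<in> L \<longrightarrow> x \<in> K"
  shows "L \<subseteq> K"
proof -
  have "negligible (interior L - K)"
  proof -
    have "interior L - K \<in> null_sets lborel"
      using AE assms(2) interior_subset[of L] by (subst AE_iff_null_sets) auto
    then show ?thesis
      by (simp add: negligible_iff_null_sets null_sets_completionI)
  qed
  then have "interior L - K = {}"
    using open_not_negligible[of "interior L - K"] assms(2) by (auto simp: open_Diff)
  then have "closure (interior L) \<subseteq> K"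
    using assms(2) by (intro closure_minimal) auto
  moreover have "closure (interior L) = L"
    using assms(1) convex_closure_interior[of L] by (simp add: convex_body_def compact_imp_closed)
  ultimately show ?thesis
    by simp
qed

lemma determined_by_moments_sublevel:
  fixes p :: "real ^ 'n \<Rightarrow> real"
  assumes p: "poly_deg_le m p" and body: "convex_body {x. p x \<le> c}"
  shows "determined_by_moments m {x. p x \<le> c}"
  unfolding determined_by_moments_def
proof (intro allI impI)
  fix L :: "(real ^ 'n) set"
  define K where "K = {x. p x \<le> c}"
  assume L: "convex_body L" and "\<forall>\<alpha>. mi_order \<alpha> \<le> m \<longrightarrow> geom_moment \<alpha> L = geom_moment \<alpha> {x. p x \<le> c}"
  then have eq: "\<And>\<alpha>. mi_order \<alpha> \<le> m \<Longrightarrow> geom_moment \<alpha> L = geom_moment \<alpha> K"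
    by (simp add: K_def)
  have cpt: "compact K" "compact L"
    using body L by (auto simp: convex_body_def K_def)
  have difference: "integrable lborel (\<lambda>x. (indicator L x - indicator K x) * f x)"
    "(\<integral>x. (indicator L x - indicator K x) * f x \<partial>lborel) = 0"
    if "poly_deg_le m f" for f :: "real ^ 'n \<Rightarrow> real"
    using set_integrable_poly_deg_le[OF that cpt(1)] set_integrable_poly_deg_le[OF that cpt(2)]
      set_integral_poly_deg_le_eq[OF that cpt eq]
    by (simp_all add: set_integrable_def set_lebesgue_integral_def left_diff_distrib)
  have q: "poly_deg_le m (\<lambda>x. p x + - c)"
    using p by (intro poly_deg_le.add poly_deg_le_const)
  \<comment> \<open>Both factors are nonnegative on \<open>L - K\<close> and nonpositive on
    \<open>K - L\<close>, and the first vanishes elsewhere. A nonnegative integrand with integral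
    zero vanishes almost everywhere.\<close>
  have "AE x in lborel. (indicator L x - indicator K x) * (p x + - c) = 0"
    using difference[OF q]
    by (subst integral_nonneg_eq_0_iff_AE[symmetric])
       (auto simp: K_def indicator_def mult_nonpos_nonpos)
  then have "L \<subseteq> K"
    using L cpt
    by (intro convex_body_subset_if_AE) (auto simp: compact_imp_closed K_def indicator_def elim!: eventually_mono)
  \<comment> \<open>Now \<open>L \<subseteq> K\<close>, so the constant polynomial -1 makes the
    integrand nonnegative; its integral is the difference of the volumes.\<close>
  have "AE x in lborel. (indicator L x - indicator K x) * (- 1) = (0 :: real)"
    using difference[OF poly_deg_le_const[of m "- 1"]] \<open>L \<subseteq> K\<close>
    by (subst integral_nonneg_eq_0_iff_AE[symmetric]) (auto simp: indicator_def)
  then have "K \<subseteq> L"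
    using body cpt
    by (intro convex_body_subset_if_AE)
       (auto simp: compact_imp_closed K_def indicator_def elim!: eventually_mono split: if_splits)
  with \<open>L \<subseteq> K\<close> show "L = {x. p x \<le> c}"
    by (simp add: K_def)
qed

section \<open>Approximation by sublevel sets\<close>

lemma separating_slab:
  fixes K :: "'a::euclidean_space set"
  assumes "compact K" "convex K" "y \<notin> K"
  obtains a b where "\<And>x. x \<in> K \<Longrightarrow> \<bar>inner a x + b\<bar> < 1" and "\<bar>inner a y + b\<bar> > 1"
proof -
  obtain a b where y: "inner a y < b" and K: "\<And>x. x \<in> K \<Longrightarrow> inner a x > b"
    using separating_hyperplane_closed_point[of K y] assms by (auto simp: compact_imp_closed)
  have "bounded (inner a ` K)"
    using assms(1) by (intro compact_imp_bounded compact_continuous_image continuous_intros)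
  then obtain B where B: "\<And>x. x \<in> K \<Longrightarrow> \<bar>inner a x\<bar> < B"
    by (auto simp: bounded_pos_less)
  \<comment> \<open>The term \<open>b + 1\<close> secures \<open>M > b\<close> even when
    \<open>K\<close> is empty.\<close>
  define M where "M = max B (b + 1)"
  have M: "\<And>x. x \<in> K \<Longrightarrow> inner a x < M" and "M > b"
    using B by (auto simp: M_def abs_less_iff less_max_iff_disj)
  \<comment> \<open>Midpoint and half-width of the interval from \<open>b\<close> to
    \<open>M\<close>; recentring and rescaling turn it into the interval from -1 to 1.\<close>
  define c w where "c = (M + b) / 2" and "w = (M - b) / 2"
  have "w > 0"
    using \<open>M > b\<close> by (simp add: w_def)
  have l: "inner (a /\<^sub>R w) x + - c / w = (inner a x - c) / w" for x
    by (simp add: divide_inverse_commute right_diff_distrib)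
  show ?thesis
  proof
    show "\<bar>inner (a /\<^sub>R w) x + - c / w\<bar> < 1" if "x \<in> K" for x
      unfolding l using K[OF that] M[OF that] \<open>w > 0\<close> by (simp add: c_def w_def abs_less_iff field_simps)
    show "\<bar>inner (a /\<^sub>R w) y + - c / w\<bar> > 1"
      unfolding l using y \<open>w > 0\<close> by (simp add: c_def w_def abs_if field_simps)
  qed
qed

lemma convex_on_affine_even_power:
  fixes a :: "'a::real_inner"
  shows "convex_on UNIV (\<lambda>x. (inner a x + b) ^ (2 * k))"
proof (rule convex_onI)
  fix t :: real and x y :: 'a
  assume t: "0 < t" "t < 1"
  have "convex_on UNIV (\<lambda>u::real. u ^ (2 * k))"
    by (intro convex_power_even) simp
  from convex_onD[OF this, of t "inner a x + b" "inner a y + b"] t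
  show "(inner a ((1 - t) *\<^sub>R x + t *\<^sub>R y) + b) ^ (2 * k)
      \<le> (1 - t) * (inner a x + b) ^ (2 * k) + t * (inner a y + b) ^ (2 * k)"
    by (simp add: inner_add_right algebra_simps)
qed simp

lemma convex_sublevel:
  assumes "convex_on UNIV f"
  shows "convex {x. f x \<le> c}"
proof (rule convexI)
  fix x y and u v :: real
  assume *: "x \<in> {x. f x \<le> c}" "y \<in> {x. f x \<le> c}" "0 \<le> u" "0 \<le> v" "u + v = 1"
  then show "u *\<^sub>R x + v *\<^sub>R y \<in> {x. f x \<le> c}"
    using convex_lower[OF assms, of x y u v] by auto
qed

text \<open>The maximum of \<open>\<bar>f\<bar>\<close> on the compact set is attained and below 1,
  so its powers bound all others uniformly.\<close>

lemma eventually_even_powers_small: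
  fixes f :: "'a::topological_space \<Rightarrow> real"
  assumes "compact K" "continuous_on K f" "\<And>x. x \<in> K \<Longrightarrow> \<bar>f x\<bar> < 1" "\<delta> > 0"
  shows "\<forall>\<^sub>F k in sequentially. \<forall>x\<in>K. f x ^ (2 * k) < \<delta>"
proof (cases "K = {}")
  case False
  obtain z where z: "z \<in> K" "\<And>x. x \<in> K \<Longrightarrow> \<bar>f x\<bar> \<le> \<bar>f z\<bar>"
    using continuous_attains_sup[OF assms(1) False, of "\<lambda>x. \<bar>f x\<bar>"] assms(2)
    by (auto intro: continuous_intros)
  have "(\<lambda>k. ((f z)\<^sup>2) ^ k) \<longlonglongrightarrow> 0"
    using assms(3)[OF z(1)] by (intro LIMSEQ_power_zero) (simp add: abs_square_less_1)
  then have "\<forall>\<^sub>F k in sequentially. ((f z)\<^sup>2) ^ k < \<delta>"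
    using assms(4) by (rule order_tendstoD)
  then show ?thesis
  proof (rule eventually_mono)
    fix k
    assume k: "((f z)\<^sup>2) ^ k < \<delta>"
    show "\<forall>x\<in>K. f x ^ (2 * k) < \<delta>"
    proof
      fix x
      assume "x \<in> K"
      then have "((f x)\<^sup>2) ^ k \<le> ((f z)\<^sup>2) ^ k"
        using z(2) by (intro power_mono[of "(f x)\<^sup>2"]) (simp_all flip: abs_le_square_iff)
      with k show "f x ^ (2 * k) < \<delta>"
        by (simp add: power_mult)
    qed
  qed
qed simp

text \<open>The complements of the closed slabs whose interiors contain \<open>K\<close> form an
  open cover of the compact set \<open>S\<close>.\<close>

lemma finitely_many_slabs:
  fixes K S :: "'a::euclidean_space set"
  assumes "compact K" "convex K" "compact S" "S \<inter> K = {}"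
  obtains F where "finite F" "\<And>a b x. (a, b) \<in> F \<Longrightarrow> x \<in> K \<Longrightarrow> \<bar>inner a x + b\<bar> < 1"
    "\<And>y. y \<in> S \<Longrightarrow> \<exists>(a, b)\<in>F. \<bar>inner a y + b\<bar> > 1"
proof -
  define G where "G = {(a, b). \<forall>x\<in>K. \<bar>inner a x + b\<bar> < 1}"
  define U where "U = (\<lambda>(a, b). {y. 1 < \<bar>inner a y + b\<bar>} :: 'a set)"
  have "open (U ab)" for ab
    unfolding U_def by (cases ab) (simp add: open_Collect_less continuous_intros)
  moreover have "S \<subseteq> (\<Union>ab\<in>G. U ab)"
  proof
    fix y
    assume "y \<in> S"
    then have "y \<notin> K"
      using assms(4) by auto
    from separating_slab[OF assms(1,2) this] obtain a b
      where "\<And>x. x \<in> K \<Longrightarrow> \<bar>inner a x + b\<bar> < 1" "\<bar>inner a y + b\<bar> > 1" by blast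
    then show "y \<in> (\<Union>ab\<in>G. U ab)"
      by (intro UN_I[of "(a, b)"]) (simp_all add: G_def U_def)
  qed
  ultimately obtain F where F: "F \<subseteq> G" "finite F" "S \<subseteq> (\<Union>ab\<in>F. U ab)"
    using compactE_image[OF assms(3), of G U] by blast
  show ?thesis
  proof
    show "finite F" by fact
    show "\<bar>inner a x + b\<bar> < 1" if "(a, b) \<in> F" "x \<in> K" for a b x
      using F(1) that by (auto simp: G_def)
    show "\<exists>(a, b)\<in>F. \<bar>inner a y + b\<bar> > 1" if "y \<in> S" for y
      using F(3) that by (force simp: U_def)
  qed
qed

text \<open>Points of \<open>K\<close> have distance 0 from \<open>L\<close>, so only the supremum
  over \<open>L\<close> matters.\<close>

lemma hausdorff_dist_le_if_subset:
  assumes "K \<noteq> {}" "K \<subseteq> L" "\<And>x. x \<in> L \<Longrightarrow> infdist x K \<le> e"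
  shows "hausdorff_dist K L \<le> e"
proof -
  have "e \<ge> 0"
    using assms infdist_nonneg order_trans by blast
  then show ?thesis
    unfolding hausdorff_dist_def using assms
    by (intro max.boundedI cSUP_least) (auto simp: subsetD)
qed

theorem theorem3p8:
  fixes K :: "(real ^ 'n) set"
  assumes "convex_body K"
  shows "\<forall>\<epsilon>>0. \<exists>m\<ge>1. \<exists>K\<^sub>m :: (real ^ 'n) set.
           convex_body K\<^sub>m \<and> determined_by_moments m K\<^sub>m \<and> hausdorff_dist K K\<^sub>m \<le> \<epsilon>"
proof (intro allI impI)
  fix \<epsilon> :: real
  assume "\<epsilon> > 0"
  have K: "compact K" "convex K" "interior K \<noteq> {}" "K \<noteq> {}"
    using assms interior_subset[of K] by (auto simp: convex_body_def)
  define S where "S = {x. infdist x K = \<epsilon>}"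
  have cpt: "compact {x. infdist x K \<le> \<epsilon>}"
    using K \<open>\<epsilon> > 0\<close> by (intro compact_infdist_le) auto
  have "closed S"
    unfolding S_def by (intro closed_Collect_eq continuous_intros)
  moreover have "S \<subseteq> {x. infdist x K \<le> \<epsilon>}"
    by (auto simp: S_def)
  ultimately have "compact S"
    using compact_Int_closed[OF cpt, of S] by (simp add: Int_absorb1)
  moreover have "S \<inter> K = {}"
    using \<open>\<epsilon> > 0\<close> by (auto simp: S_def)
  ultimately obtain F where "finite F"
    and F_K: "\<And>a b x. (a, b) \<in> F \<Longrightarrow> x \<in> K \<Longrightarrow> \<bar>inner a x + b\<bar> < 1"
    and F_S: "\<And>y. y \<in> S \<Longrightarrow> \<exists>(a, b)\<in>F. \<bar>inner a y + b\<bar> > 1"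
    using finitely_many_slabs[OF K(1,2)] by metis
  let ?l = "\<lambda>ab x. inner (fst ab) x + snd ab"
  \<comment> \<open>Chosen so that \<open>card F\<close> terms below it sum to at most 1; adding 1
    keeps the denominator positive when \<open>F\<close> is empty.\<close>
  let ?\<delta> = "1 / (real (card F) + 1)"
  have "\<forall>\<^sub>F k in sequentially. \<forall>x\<in>K. ?l ab x ^ (2 * k) < ?\<delta>" if "ab \<in> F" for ab
    using K(1)
  proof (rule eventually_even_powers_small)
    show "\<bar>?l ab x\<bar> < 1" if "x \<in> K" for x
      using F_K[of "fst ab" "snd ab" x] \<open>ab \<in> F\<close> that by simp
  qed (auto intro!: continuous_intros)
  then have "\<forall>\<^sub>F k in sequentially. \<forall>ab\<in>F. \<forall>x\<in>K. ?l ab x ^ (2 * k) < ?\<delta>"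
    using \<open>finite F\<close> by (intro eventually_ball_finite) simp_all
  \<comment> \<open>A positive exponent is required for powers of numbers above 1 to stay above 1,
    and it also gives an order of at least 1.\<close>
  then have "\<forall>\<^sub>F k in sequentially. k \<ge> 1 \<and> (\<forall>ab\<in>F. \<forall>x\<in>K. ?l ab x ^ (2 * k) < ?\<delta>)"
    using eventually_ge_at_top eventually_conj by blast
  then obtain k where "k \<ge> 1" and small: "\<And>ab x. ab \<in> F \<Longrightarrow> x \<in> K \<Longrightarrow> ?l ab x ^ (2 * k) < ?\<delta>"
    by (auto simp: eventually_sequentially)
  define p where "p = (\<lambda>x. \<Sum>ab\<in>F. ?l ab x ^ (2 * k))"
  define L where "L = {x. p x \<le> 1}"
  have p: "poly_deg_le (2 * k) p"
    unfolding p_def by (intro poly_deg_le_sum poly_deg_le_affine_power)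
  have "K \<subseteq> L"
  proof
    fix x
    assume "x \<in> K"
    then have "p x \<le> real (card F) * ?\<delta>"
      unfolding p_def using small by (intro sum_bounded_above) (simp add: less_imp_le)
    also have "\<dots> \<le> 1"
      by simp
    finally show "x \<in> L"
      by (simp add: L_def)
  qed
  have "convex_on UNIV p"
    unfolding p_def using \<open>finite F\<close>
    by (induction F) (simp_all add: convex_on_const convex_on_add convex_on_affine_even_power)
  then have "convex L"
    unfolding L_def by (rule convex_sublevel)
  have "L \<inter> S = {}"
  proof (rule ccontr)
    assume "L \<inter> S \<noteq> {}"
    then obtain y where "y \<in> L" "y \<in> S"
      by blast
    then obtain ab where ab: "ab \<in> F" "\<bar>?l ab y\<bar> > 1"
      using F_S by fastforce
    have "1 < \<bar>?l ab y\<bar> ^ (2 * k)"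
      using ab(2) \<open>k \<ge> 1\<close> by (intro one_less_power) simp_all
    also have "\<dots> = ?l ab y ^ (2 * k)"
      by (simp add: power_even_abs)
    also have "\<dots> \<le> p y"
      unfolding p_def using \<open>finite F\<close> ab(1)
      by (intro member_le_sum[of ab F "\<lambda>ab. ?l ab y ^ (2 * k)"]) simp_all
    finally show False
      using \<open>y \<in> L\<close> by (simp add: L_def)
  qed
  have near: "infdist x K \<le> \<epsilon>" if "x \<in> L" for x
  proof (rule ccontr)
    assume "\<not> infdist x K \<le> \<epsilon>"
    obtain z where "z \<in> K"
      using K(4) by blast
    \<comment> \<open>On \<open>L\<close> the distance to \<open>K\<close> takes the value 0;
      exceeding \<open>\<epsilon>\<close>, it would also take the value \<open>\<epsilon>\<close>,
      at a point of \<open>S\<close>.\<close>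
    have "connected ((\<lambda>x. infdist x K) ` L)"
      using \<open>convex L\<close> by (intro connected_continuous_image continuous_intros convex_connected)
    moreover have "0 \<in> (\<lambda>x. infdist x K) ` L"
      using \<open>z \<in> K\<close> \<open>K \<subseteq> L\<close> by (intro image_eqI[of _ _ z]) auto
    ultimately have "\<epsilon> \<in> (\<lambda>x. infdist x K) ` L"
      using connectedD_interval[OF _ _ imageI[OF that], of "\<lambda>x. infdist x K" 0 \<epsilon>]
        \<open>\<epsilon> > 0\<close> \<open>\<not> infdist x K \<le> \<epsilon>\<close> by simp
    then show False
      using \<open>L \<inter> S = {}\<close> by (auto simp: S_def)
  qed
  have "closed L"
    unfolding L_def using continuous_on_poly_deg_le[OF p]
    by (intro closed_Collect_le continuous_intros) auto
  then have "compact L"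
    using compact_Int_closed[OF cpt, of L] near by (simp add: Int_absorb1 subset_iff)
  then have "convex_body L"
    using \<open>convex L\<close> K(3) interior_mono[OF \<open>K \<subseteq> L\<close>] by (auto simp: convex_body_def)
  moreover have "determined_by_moments (2 * k) L"
    unfolding L_def using p \<open>convex_body L\<close> by (intro determined_by_moments_sublevel) (simp_all add: L_def)
  moreover have "hausdorff_dist K L \<le> \<epsilon>"
    using K(4) \<open>K \<subseteq> L\<close> near by (rule hausdorff_dist_le_if_subset)
  ultimately show "\<exists>m\<ge>1. \<exists>K\<^sub>m. convex_body K\<^sub>m \<and> determined_by_moments m K\<^sub>m \<and> hausdorff_dist K K\<^sub>m \<le> \<epsilon>"
    using \<open>k \<ge> 1\<close> by (intro exI[of _ "2 * k"] exI[of _ L] conjI) auto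
qed

end
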